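(* Let $\mathfrak{I}=(X,\mathcal{F},\Sigma)$ be an IFS where $\Sigma$ is an irreducible sofic subshift. Assume that $x\in X$ is periodic of period $p$ along some $\sigma\in\Sigma$. Then there are $q\in\mathbb{N}$ and a word $u'$ with $|u'|=qp$ such that $\sigma'=(u')^\infty\in\Sigma$ and $x$ is orbitally periodic, of period $|u'|$, for $f_{\sigma'_1,\infty}$.
   Context: $(X,d)$ is a compact metric space, $\mathcal{F}=\{f_0,\ldots,f_{k-1}\}$ is a finite set of continuous self-maps of $X$, $\mathcal{A}=\{0,\ldots,k-1\}$, and $\Sigma\subseteq\mathcal{A}^{\mathbb{N}}$ is a one-sided subshift (closed set invariant under the shift map). The triple $\mathfrak{I}=(X,\mathcal{F},\Sigma)$ is called an iterated function system (IFS). For a word $u=u_1\cdots u_n$, $|u|=n$, $f_u=f_{u_n}\circ\cdots\circ f_{u_1}$, and $u^\infty=uuu\cdots$. For $\sigma=\sigma_1\sigma_2\cdots\in\Sigma$, $f_{\sigma_1,\infty}=\cdots\circ f_{\sigma_2}\circ f_{\sigma_1}$ is the non-autonomous system along $\sigma$. A subshift is of finite type (SFT) if it can be defined by a finite set of forbidden words; it is sofic if it is a factor of an SFT (image under a sliding block code), equivalently if it is presented by a finite labeled directed graph. $\Sigma$ is irreducible if for all words $u,v$ in its language there is a word $w$ with $uwv$ in its language. A point $x\in X$ is periodic of period $p$ along $\sigma$ if $f_{\sigma_1\cdots\sigma_{\ell p}}(x)=x$ for every $\ell\in\mathbb{N}$. It is regularly periodic of period $p$ for $f_{\sigma_1,\infty}$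 if $f_{\sigma_1\cdots\sigma_i}(x)=f_{\sigma_1\cdots\sigma_{i+p}}(x)$ for every $i\ge1$. It is orbitally periodic of period $p$ for $f_{\sigma_1,\infty}$ if there is a non-empty word $u$ with $|u|=p$ and $\sigma=u^\infty$, and $x$ is regularly periodic of period $p$ for $f_{\sigma_1,\infty}$. *)

theory Defs
  imports "HOL-Analysis.Analysis"
begin

text \<open>
  Infinite sequences over the alphabet \<open>{0, \<dots>, k - 1}\<close> are functions \<^typ>\<open>nat \<Rightarrow> nat\<close>, indexed from
  0: the value \<open>\<sigma> i\<close> is the letter \<open>\<sigma>\<^sub>i\<^sub>+\<^sub>1\<close> of the usual 1-based notation. Finite words are lists.
\<close>

definition segment :: "(nat \<Rightarrow> 'b) \<Rightarrow> nat \<Rightarrow> nat \<Rightarrow> 'b list" where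
  "segment \<sigma> i n = map \<sigma> [i..<i + n]"

definition shift_map :: "(nat \<Rightarrow> 'b) \<Rightarrow> nat \<Rightarrow> 'b" where
  "shift_map \<sigma> = (\<lambda>i. \<sigma> (Suc i))"

definition full_shift :: "nat \<Rightarrow> (nat \<Rightarrow> nat) set" where
  "full_shift k = {\<sigma>. range \<sigma> \<subseteq> {..<k}}"

text \<open>
  Here \<^const>\<open>closed\<close> refers to the product topology on \<^typ>\<open>nat \<Rightarrow> nat\<close>, with \<^typ>\<open>nat\<close> discrete. The
  full shift is closed in it, so this is the same as being closed in the full shift.
\<close>

definition subshift :: "nat \<Rightarrow> (nat \<Rightarrow> nat) set \<Rightarrow> bool" where
  "subshift k S \<longleftrightarrow> S \<subseteq> full_shift k \<and> closed S \<and> shift_map ` S \<subseteq> S"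

definition language :: "(nat \<Rightarrow> 'b) set \<Rightarrow> 'b list set" where
  "language S = {segment \<sigma> i n | \<sigma> i n. \<sigma> \<in> S}"

definition irreducible_shift :: "(nat \<Rightarrow> 'b) set \<Rightarrow> bool" where
  "irreducible_shift S \<longleftrightarrow> (\<forall>u\<in>language S. \<forall>v\<in>language S. \<exists>w. u @ w @ v \<in> language S)"

definition SFT :: "nat \<Rightarrow> (nat \<Rightarrow> nat) set \<Rightarrow> bool" where
  "SFT m S \<longleftrightarrow> (\<exists>W. finite W \<and> S = {\<sigma> \<in> full_shift m. \<forall>i n. segment \<sigma> i n \<notin> W})"

text \<open>On one-sided sequences a sliding block code has no memory, only a window of \<open>r\<close> letters to the right.\<close>

definition block_code :: "nat \<Rightarrow> ('b list \<Rightarrow> 'c) \<Rightarrow> (nat \<Rightarrow> 'b) \<Rightarrow> nat \<Rightarrow> 'c" where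
  "block_code r \<Phi> \<sigma> = (\<lambda>i. \<Phi> (segment \<sigma> i r))"

text \<open>
  The covering SFT may have a different finite alphabet; up to renaming letters it is \<open>{..<m}\<close>.
\<close>

definition sofic :: "(nat \<Rightarrow> nat) set \<Rightarrow> bool" where
  "sofic S \<longleftrightarrow> (\<exists>m T r \<Phi>. SFT m T \<and> S = block_code r \<Phi> ` T)"

text \<open>
  The maps \<open>f 0, \<dots>, f (k - 1)\<close> need not be distinct; \<open>f i\<close> is irrelevant for \<open>i \<ge> k\<close>.
\<close>

definition IFS :: "'a::metric_space set \<Rightarrow> nat \<Rightarrow> (nat \<Rightarrow> 'a \<Rightarrow> 'a) \<Rightarrow> (nat \<Rightarrow> nat) set \<Rightarrow> bool" where
  "IFS X k f S \<longleftrightarrow>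
     compact X \<and> (\<forall>i<k. continuous_on X (f i) \<and> f i ` X \<subseteq> X) \<and> subshift k S"

text \<open>
  For a word \<open>u = u\<^sub>1 \<dots> u\<^sub>n\<close>, \<^term>\<open>fold f u\<close> is the composition applying \<open>f u\<^sub>1\<close> first and
  \<open>f u\<^sub>n\<close> last. Below, \<open>orbit f \<sigma> x n\<close> is the image of \<open>x\<close> under the word of the first \<open>n\<close> letters of \<open>\<sigma>\<close>.
\<close>

definition orbit :: "('b \<Rightarrow> 'a \<Rightarrow> 'a) \<Rightarrow> (nat \<Rightarrow> 'b) \<Rightarrow> 'a \<Rightarrow> nat \<Rightarrow> 'a" where
  "orbit f \<sigma> x n = fold f (segment \<sigma> 0 n) x"

definition infinite_power :: "'b list \<Rightarrow> nat \<Rightarrow> 'b" where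
  "infinite_power u = (\<lambda>i. u ! (i mod length u))"

text \<open>Regular periodicity does not constrain \<open>x\<close> itself: the condition starts at \<open>i = 1\<close>. Periods are positive.\<close>

definition periodic_along :: "('b \<Rightarrow> 'a \<Rightarrow> 'a) \<Rightarrow> (nat \<Rightarrow> 'b) \<Rightarrow> nat \<Rightarrow> 'a \<Rightarrow> bool" where
  "periodic_along f \<sigma> p x \<longleftrightarrow> p > 0 \<and> (\<forall>l. orbit f \<sigma> x (l * p) = x)"

definition regularly_periodic :: "('b \<Rightarrow> 'a \<Rightarrow> 'a) \<Rightarrow> (nat \<Rightarrow> 'b) \<Rightarrow> nat \<Rightarrow> 'a \<Rightarrow> bool" where
  "regularly_periodic f \<sigma> p x \<longleftrightarrow> p > 0 \<and> (\<forall>i\<ge>1. orbit f \<sigma> x i = orbit f \<sigma> x (i + p))"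

definition orbitally_periodic :: "('b \<Rightarrow> 'a \<Rightarrow> 'a) \<Rightarrow> (nat \<Rightarrow> 'b) \<Rightarrow> nat \<Rightarrow> 'a \<Rightarrow> bool" where
  "orbitally_periodic f \<sigma> p x \<longleftrightarrow>
     (\<exists>u. u \<noteq> [] \<and> length u = p \<and> \<sigma> = infinite_power u) \<and> regularly_periodic f \<sigma> p x"

end

theory Submission
  imports Defs
begin

text \<open>
  Write \<open>\<sigma>\<close> as the image under a block code of a point \<open>\<tau>\<close> of a covering SFT. Among the long
  windows of \<open>\<tau>\<close> that start at multiples of \<open>p\<close> two coincide. Repeating the part of \<open>\<tau>\<close> between
  them forever creates no new window, so it gives a periodic point of the SFT, whose image is
  \<open>(u')\<^sup>\<infinity>\<close> for a subword \<open>u'\<close> of \<open>\<sigma>\<close> between two multiples of \<open>p\<close>. The orbit of \<open>x\<close> is at \<open>x\<close> at both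
  ends of \<open>u'\<close>, so \<open>u'\<close> fixes \<open>x\<close>.
\<close>

lemma length_segment [simp]: "length (segment \<sigma> i n) = n"
  by (simp add: segment_def)

lemma nth_segment [simp]: "j < n \<Longrightarrow> segment \<sigma> i n ! j = \<sigma> (i + j)"
  by (simp add: segment_def)

lemma segment_eq_iff: "segment \<sigma> i n = segment \<tau> j n \<longleftrightarrow> (\<forall>l<n. \<sigma> (i + l) = \<tau> (j + l))"
  by (simp add: list_eq_iff_nth_eq)

lemma segment_add: "segment \<sigma> i (m + n) = segment \<sigma> i m @ segment \<sigma> (i + m) n"
  by (simp add: segment_def flip: map_append upt_add_eq_append add.assoc)

lemma orbit_add: "orbit f \<sigma> x (m + n) = fold f (segment \<sigma> m n) (orbit f \<sigma> x m)"
  by (simp add: orbit_def segment_add)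

lemma segment_infinite_power_mod:
  "segment (infinite_power u) (i mod length u) n = segment (infinite_power u) i n"
  by (simp add: segment_eq_iff infinite_power_def mod_add_left_eq)

text \<open>Finitely many forbidden words have bounded length, so a sequence all of whose
  sufficiently long windows occur in a point of \<open>T\<close> contains none of them. Any
  \<open>M\<close> above the threshold \<open>N\<close> is allowed, so that the window can later be
  enlarged to suit a block code as well.\<close>

lemma SFT_mem_of_windows:
  assumes "SFT m T"
  obtains N where "\<And>M \<tau> \<tau>'. N \<le> M \<Longrightarrow> \<tau> \<in> T \<Longrightarrow>
    (\<And>i. \<exists>j. segment \<tau>' i M = segment \<tau> j M) \<Longrightarrow> \<tau>' \<in> T"
proof -
  obtain W where W: "finite W" and T: "T = {\<sigma> \<in> full_shift m. \<forall>i n. segment \<sigma> i n \<notin> W}"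
    using assms by (auto simp: SFT_def)
  obtain N where N: "\<And>w. w \<in> W \<Longrightarrow> length w \<le> N"
    using W by (metis finite_imageI finite_nat_set_iff_bounded_le image_eqI)
  show thesis
  proof (rule that)
    fix M \<tau> \<tau>'
    \<comment> \<open>The threshold is \<open>Suc N\<close> because \<open>N\<close> may be 0:
      windows must be non-empty for their first letters to show that \<open>\<tau>'\<close> stays in
      the alphabet.\<close>
    assume M: "Suc N \<le> M" and "\<tau> \<in> T" and win: "\<And>i. \<exists>j. segment \<tau>' i M = segment \<tau> j M"
    have "\<tau>' i < m" for i
    proof -
      obtain j where "segment \<tau>' i M = segment \<tau> j M" using win by blast
      then have "\<tau>' (i + 0) = \<tau> (j + 0)"
        using M unfolding segment_eq_iff by (metis Suc_le_lessD less_zeroE not_gr_zero)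
      then show ?thesis
        using \<open>\<tau> \<in> T\<close> by (auto simp: T full_shift_def)
    qed
    moreover have "segment \<tau>' i n \<notin> W" for i n
    proof
      assume *: "segment \<tau>' i n \<in> W"
      then have "n \<le> M" using N[OF *] M by simp
      obtain j where "segment \<tau>' i M = segment \<tau> j M" using win by blast
      then have "segment \<tau>' i n = segment \<tau> j n"
        using \<open>n \<le> M\<close> by (simp add: segment_eq_iff)
      then show False using * \<open>\<tau> \<in> T\<close> by (simp add: T)
    qed
    ultimately show "\<tau>' \<in> T" by (auto simp: T full_shift_def)
  qed
qed

text \<open>The period \<open>P\<close> may be shorter than the repeated window \<open>M\<close>; the induction handles the overlaps.\<close>

lemma infinite_power_segment_extend:
  assumes "P > 0" and rep: "segment \<tau> a M = segment \<tau> (a + P) M" and "i < P + M"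
  shows "infinite_power (segment \<tau> a P) i = \<tau> (a + i)"
  using \<open>i < P + M\<close>
proof (induction i rule: less_induct)
  case (less i)
  show ?case
  proof (cases "i < P")
    case True
    then show ?thesis by (simp add: infinite_power_def)
  next
    case False
    then have "infinite_power (segment \<tau> a P) i = infinite_power (segment \<tau> a P) (i - P)"
      by (simp add: infinite_power_def le_mod_geq)
    also have "\<dots> = \<tau> (a + (i - P))"
      using less False \<open>P > 0\<close> by simp
    also have "\<dots> = \<tau> (a + P + (i - P))"
      using rep[unfolded segment_eq_iff, rule_format, of "i - P"] less.prems False by linarith
    finally show ?thesis using False by simp
  qed
qed

text \<open>By periodicity the start may be reduced below \<open>P\<close>. A window of length at
  most \<open>M\<close> then ends within the first \<open>P + M\<close> letters, where the periodic
  sequence still agrees with \<open>\<tau>\<close> read from \<open>a\<close>.\<close>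

lemma segment_infinite_power_window:
  assumes "P > 0" and "segment \<tau> a M = segment \<tau> (a + P) M" and "n \<le> M"
  shows "segment (infinite_power (segment \<tau> a P)) i n = segment \<tau> (a + i mod P) n"
proof -
  have "segment (infinite_power (segment \<tau> a P)) i n
      = segment (infinite_power (segment \<tau> a P)) (i mod P) n"
    by (metis length_segment segment_infinite_power_mod)
  also have "\<dots> = segment \<tau> (a + i mod P) n"
    unfolding segment_eq_iff
  proof (intro allI impI)
    fix l assume "l < n"
    then have "i mod P + l < P + M"
      using assms(3) mod_less_divisor[OF assms(1), of i] by linarith
    then show "infinite_power (segment \<tau> a P) (i mod P + l) = \<tau> (a + i mod P + l)"
      by (simp add: infinite_power_segment_extend[OF assms(1,2)] add.assoc)
  qed
  finally show ?thesis .
qed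

text \<open>Pigeonhole: there are infinitely many \<open>l\<close> but only finitely many words of
  length \<open>M\<close> over \<open>m\<close> letters.\<close>

lemma full_shift_segment_recurs:
  assumes "\<tau> \<in> full_shift m"
  obtains l l' :: nat where "l < l'" "segment \<tau> (l * p) M = segment \<tau> (l' * p) M"
proof -
  let ?g = "\<lambda>l. segment \<tau> (l * p) M"
  have "range ?g \<subseteq> {w. set w \<subseteq> {..<m} \<and> length w = M}"
    using assms by (fastforce simp: full_shift_def segment_def)
  then have "finite (range ?g)"
    by (rule finite_subset) (simp add: finite_lists_length_eq)
  then have "\<not> inj ?g"
    using finite_imageD by blast
  then obtain l l' where "l \<noteq> l'" "?g l = ?g l'"
    unfolding inj_def by blast
  then show thesis
    using that by (metis linorder_neqE_nat)
qed

lemma sofic_periodic_point: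
  assumes "sofic S" "\<sigma> \<in> S" "p > 0"
  obtains l q where "q \<ge> 1" "infinite_power (segment \<sigma> (l * p) (q * p)) \<in> S"
proof -
  obtain m T r \<Phi> where T: "SFT m T" and S: "S = block_code r \<Phi> ` T"
    using assms(1) by (auto simp: sofic_def)
  obtain \<tau> where \<tau>: "\<tau> \<in> T" and \<sigma>: "\<sigma> = block_code r \<Phi> \<tau>"
    using assms(2) S by blast
  obtain N where N: "\<And>M \<tau> \<tau>'. N \<le> M \<Longrightarrow> \<tau> \<in> T \<Longrightarrow>
      (\<And>i. \<exists>j. segment \<tau>' i M = segment \<tau> j M) \<Longrightarrow> \<tau>' \<in> T"
    using SFT_mem_of_windows[OF T] by blast
  \<comment> \<open>Windows of length \<open>N\<close> decide membership in \<open>T\<close>, and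
    those of length \<open>r\<close> determine the letters of the image under the block code; one
    repetition must serve both.\<close>
  define M where "M = max N r"
  have "\<tau> \<in> full_shift m"
    using T \<tau> by (auto simp: SFT_def)
  then obtain l l' where "l < l'" and rep: "segment \<tau> (l * p) M = segment \<tau> (l' * p) M"
    by (rule full_shift_segment_recurs)
  define q where "q = l' - l"
  have "q \<ge> 1" and l': "l' * p = l * p + q * p"
    using \<open>l < l'\<close> by (simp_all add: q_def flip: add_mult_distrib)
  then have P: "q * p > 0" using \<open>p > 0\<close> by simp
  note window = segment_infinite_power_window[OF P rep[unfolded l']]
  let ?\<tau>' = "infinite_power (segment \<tau> (l * p) (q * p))"
  have "?\<tau>' \<in> T"
  proof (rule N[OF _ \<tau>])
    show "N \<le> M" by (simp add: M_def)
    show "\<exists>j. segment ?\<tau>' i M = segment \<tau> j M" for i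
      using window by blast
  qed
  moreover have "block_code r \<Phi> ?\<tau>' = infinite_power (segment \<sigma> (l * p) (q * p))"
  proof
    fix i
    \<comment> \<open>As \<open>r \<le> M\<close>, the code reads at \<open>i\<close> a window of
      \<open>\<tau>\<close> itself, so it outputs a letter of \<open>\<sigma>\<close>.\<close>
    have "block_code r \<Phi> ?\<tau>' i = \<sigma> (l * p + i mod (q * p))"
      by (simp add: block_code_def \<sigma> window M_def)
    also have "\<dots> = infinite_power (segment \<sigma> (l * p) (q * p)) i"
      using P by (simp add: infinite_power_def)
    finally show "block_code r \<Phi> ?\<tau>' i = infinite_power (segment \<sigma> (l * p) (q * p)) i" .
  qed
  ultimately show thesis
    using that \<open>q \<ge> 1\<close> S by (metis image_eqI)
qed

text \<open>After \<open>length u\<close> letters the point is back at \<open>x\<close> and the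
  remaining sequence is again \<open>infinite_power u\<close>, so the orbit starts over.\<close>

lemma orbitally_periodic_infinite_power:
  assumes "u \<noteq> []" "fold f u x = x"
  shows "orbitally_periodic f (infinite_power u) (length u) x"
proof -
  let ?\<sigma> = "infinite_power u"
  have "segment ?\<sigma> 0 (length u) = u"
    by (simp add: list_eq_iff_nth_eq infinite_power_def)
  then have "orbit f ?\<sigma> x (length u) = x"
    using assms(2) by (simp add: orbit_def)
  \<comment> \<open>The start \<open>length u\<close> is 0 modulo \<open>length u\<close>.\<close>
  moreover have "segment ?\<sigma> (length u) i = segment ?\<sigma> 0 i" for i
    using segment_infinite_power_mod[of u "length u" i] by simp
  ultimately have "orbit f ?\<sigma> x (i + length u) = orbit f ?\<sigma> x i" for i
    by (simp add: add.commute[of i] orbit_add) (simp add: orbit_def)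
  then show ?thesis
    using assms(1) by (auto simp: orbitally_periodic_def regularly_periodic_def)
qed


theorem proposition4p7:
  fixes X :: "'a::metric_space set"
    and k :: nat
    and f :: "nat \<Rightarrow> 'a \<Rightarrow> 'a"
    and S :: "(nat \<Rightarrow> nat) set"
    and \<sigma> :: "nat \<Rightarrow> nat"
    and x :: 'a
    and p :: nat
  assumes "IFS X k f S"
    and "irreducible_shift S"
    and "sofic S"
    and "x \<in> X"
    and "\<sigma> \<in> S"
    and "periodic_along f \<sigma> p x"
  shows "\<exists>(q::nat) u'. q \<ge> 1 \<and> length u' = q * p \<and> infinite_power u' \<in> S \<and>
           orbitally_periodic f (infinite_power u') (length u') x"
proof -
  have p: "p > 0" and per: "\<And>l. orbit f \<sigma> x (l * p) = x"
    using assms(6) by (auto simp: periodic_along_def)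
  obtain l q where q: "q \<ge> 1" and mem: "infinite_power (segment \<sigma> (l * p) (q * p)) \<in> S"
    using sofic_periodic_point[OF assms(3,5) p] by blast
  let ?u = "segment \<sigma> (l * p) (q * p)"
  have "fold f ?u x = orbit f \<sigma> x (l * p + q * p)"
    by (simp add: orbit_add per)
  also have "\<dots> = x"
    using per[of "l + q"] by (simp add: add_mult_distrib)
  finally have "fold f ?u x = x" .
  moreover have "length ?u = q * p" by simp
  moreover have "?u \<noteq> []"
    using p q by (metis length_segment length_0_conv mult_is_0 not_gr_zero not_one_le_zero)
  ultimately show ?thesis
    using q mem orbitally_periodic_infinite_power[of ?u f x] by blast
qed

end
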